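(* Let $D(x,y)=n(x\cos\varphi+y\sin\varphi)+D_0$ with $n>0$ and $\varphi,D_0\in\mathbb{R}$ be a steady linear field, let $\bar v>0$, $\mu>0$, $d_\ast\in\mathbb{R}$, and let $0<\nu<\bar v n$. Put $\theta_\ast:=\arccos\frac{\nu}{\bar v n}$. Consider the closed-loop system $$\dot{\boldsymbol r}(t)=\bar v\,\vec e(\theta(t)),\quad \theta(t)=\mu\,[d(t)-\nu t-d_\ast],\quad d(t)=D(\boldsymbol r(t)),\quad \boldsymbol r(0)=\boldsymbol r_{\rm in}\in\mathbb{R}^2,\quad t\ge 0 .$$ Consider the following condition on the initial location: $$(\mathrm{P})\qquad \mu\,[D(\boldsymbol r_{\rm in})-d_\ast]=\varphi\pm\theta_\ast+2\pi k\ \text{ for some choice of the sign } \pm \text{ and some integer } k .$$ All trajectories are divided into two categories: (i) If (P) holds, then the robot moves at the speed $\bar v$ along a straight line subtending the angle $\theta_\ast$ with the field gradient, and the field value grows at the requested rate: $\dot d(t)\equiv\nu$. (ii) If (P) does not hold, then the trajectory $\boldsymbol r(\cdot)$ of the robot, together with its velocity orientation $\theta(\cdot)$, converges exponentially as $t\to\infty$ to a trajectory described in (i) whose velocity orientation is $\theta\equiv\varphi+\theta_\ast+2\pi k$ for some integer $k$ (i.e. the case of the sign $+$ in (P)). Meanwhile, the field value $d$ eventually ascends and $\dot d(t)\to\nu$ as $t\to\infty$. As $t$ runs from $0$ to $\infty$, the velocity orientation angle $\theta(t)$ changes monotonically and sweeps through a total angle that is less than $2\pi$.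
   Context: $\vec e(\theta):=(\cos\theta,\sin\theta)^\top$. The robot is a point in the plane, $\boldsymbol r=(x,y)^\top$; $\bar v$ is its maximal speed; $d(t)$ is the field value at its current location; $\nu,\mu,d_\ast$ are controller parameters; $\nu$ is the requested field growth rate, and it is called feasible when $\nu<\bar v n$. *)

theory Defs
  imports "HOL-Analysis.Analysis"
begin

definition evec :: "real \<Rightarrow> real ^ 2" where
  "evec \<theta> = vector [cos \<theta>, sin \<theta>]"

definition linear_field :: "real \<Rightarrow> real \<Rightarrow> real \<Rightarrow> real ^ 2 \<Rightarrow> real" where
  "linear_field n \<phi> D0 p = n * (p $ 1 * cos \<phi> + p $ 2 * sin \<phi>) + D0"

definition vec_angle :: "real ^ 2 \<Rightarrow> real ^ 2 \<Rightarrow> real" where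
  "vec_angle u w = arccos (u \<bullet> w / (norm u * norm w))"

definition theta_star :: "real \<Rightarrow> real \<Rightarrow> real \<Rightarrow> real" where
  "theta_star vbar n \<nu> = arccos (\<nu> / (vbar * n))"

text \<open>Trajectories live on the time half-line \<open>t \<ge> 0\<close>: derivatives are taken within \<open>{0..}\<close>
  (one-sided at \<open>t = 0\<close>), and values at negative times are irrelevant.\<close>

definition closed_loop ::
  "(real ^ 2 \<Rightarrow> real) \<Rightarrow> real \<Rightarrow> real \<Rightarrow> real \<Rightarrow> real \<Rightarrow> real ^ 2 \<Rightarrow>
   (real \<Rightarrow> real ^ 2) \<Rightarrow> (real \<Rightarrow> real) \<Rightarrow> (real \<Rightarrow> real) \<Rightarrow> bool" where
  "closed_loop D vbar \<mu> \<nu> dstar rin r \<theta> d \<longleftrightarrow>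
     r 0 = rin \<and>
     (\<forall>t\<ge>0. (r has_vector_derivative vbar *\<^sub>R evec (\<theta> t)) (at t within {0..}) \<and>
            \<theta> t = \<mu> * (d t - \<nu> * t - dstar) \<and>
            d t = D (r t))"

definition cond_P ::
  "(real ^ 2 \<Rightarrow> real) \<Rightarrow> real \<Rightarrow> real \<Rightarrow> real \<Rightarrow> real \<Rightarrow> real ^ 2 \<Rightarrow> bool" where
  "cond_P D \<mu> dstar \<phi> \<theta>star rin \<longleftrightarrow>
     (\<exists>k::int. \<mu> * (D rin - dstar) = \<phi> + \<theta>star + 2 * pi * of_int k \<or>
               \<mu> * (D rin - dstar) = \<phi> - \<theta>star + 2 * pi * of_int k)"

text \<open>The direction of motion \<open>u\<close> is oriented, so \<open>\<alpha>\<close> is the angle between the velocity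
  and the gradient, not the unoriented angle between two lines.\<close>

definition straight_motion ::
  "(real ^ 2 \<Rightarrow> real) \<Rightarrow> real \<Rightarrow> real \<Rightarrow> real \<Rightarrow>
   (real \<Rightarrow> real ^ 2) \<Rightarrow> (real \<Rightarrow> real) \<Rightarrow> bool" where
  "straight_motion D vbar \<alpha> \<nu> r d \<longleftrightarrow>
     (\<exists>u. norm u = 1 \<and>
          (\<forall>t\<ge>0. r t = r 0 + (vbar * t) *\<^sub>R u \<and>
                 (\<exists>g. GDERIV D (r t) :> g \<and> vec_angle u g = \<alpha>))) \<and>
     (\<forall>t\<ge>0. (d has_real_derivative \<nu>) (at t within {0..}))"

end

theory Submission
  imports Defs
begin

text \<open>The orientation obeys the autonomous equation
  \<open>\<theta>' = \<mu> vbar n (cos (\<theta> - \<phi>) - cos \<theta>\<^sub>*)\<close>. Its right-hand side \<open>g\<close> satisfies \<open>\<bar>g'\<bar> \<le> \<mu> vbar n \<bar>g\<bar>\<close>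
  along a solution, so \<open>g\<close> vanishes identically or never. In the first case the motion is straight. In
  the second case \<open>\<theta>\<close> stays strictly between two consecutive equilibria and is monotone; the
  product formula for \<open>cos x - cos y\<close> and concavity of the sine give a linear rate towards the
  stable equilibrium \<open>\<phi> + \<theta>\<^sub>* + 2\<pi>k\<close>. The velocity error is then exponentially small and
  hence integrable, which makes \<open>r t - vbar t e(\<theta>\<^sub>\<infinity>)\<close> converge; its limit is the initial point of the
  limiting straight trajectory.\<close>

section \<open>Differential inequalities on the half-line\<close>

lemma has_real_derivative_at_of_half_line:
  fixes f :: "real \<Rightarrow> real"
  assumes "(f has_real_derivative f') (at t within {0..})" "0 < t"
  shows "(f has_real_derivative f') (at t)"
proof -
  have "at t within {0..} = at t"
    using assms(2) by (intro at_within_interior) auto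
  then show ?thesis using assms(1) by simp
qed

lemma continuous_on_half_line:
  fixes f :: "real \<Rightarrow> real"
  assumes "\<And>t. 0 \<le> t \<Longrightarrow> (f has_real_derivative f' t) (at t within {0..})"
  shows "continuous_on {0..} f"
  using assms by (auto simp: continuous_on_eq_continuous_within intro!: DERIV_continuous)

lemma nonincreasing_half_line:
  fixes f :: "real \<Rightarrow> real"
  assumes der: "\<And>t. 0 \<le> t \<Longrightarrow> (f has_real_derivative f' t) (at t within {0..})"
    and le: "\<And>t. 0 \<le> t \<Longrightarrow> f' t \<le> 0" and "0 \<le> s" "s \<le> t"
  shows "f t \<le> f s"
proof (rule DERIV_nonpos_imp_decreasing_open[OF \<open>s \<le> t\<close>])
  show "\<exists>y. DERIV f x :> y \<and> y \<le> 0" if "s < x" "x < t" for x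
    using has_real_derivative_at_of_half_line[OF der] le that \<open>0 \<le> s\<close>
    by (meson less_le_trans less_imp_le le_less_trans)
  show "continuous_on {s..t} f"
    by (rule continuous_on_subset[OF continuous_on_half_line[OF der]]) (use \<open>0 \<le> s\<close> in auto)
qed

lemma strict_mono_on_half_line:
  fixes f :: "real \<Rightarrow> real"
  assumes der: "\<And>t. 0 \<le> t \<Longrightarrow> (f has_real_derivative f' t) (at t within {0..})"
    and "0 \<le> T" and pos: "\<And>t. T \<le> t \<Longrightarrow> 0 < f' t"
  shows "strict_mono_on {T..} f"
proof (rule strict_mono_onI)
  fix s t assume st: "s \<in> {T..}" "t \<in> {T..}" "s < t"
  show "f s < f t"
  proof (rule DERIV_pos_imp_increasing_open[OF \<open>s < t\<close>])
    show "\<exists>y. DERIV f x :> y \<and> 0 < y" if "s < x" "x < t" for x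
    proof -
      have "0 < x" "T \<le> x" using that st \<open>0 \<le> T\<close> by auto
      then show ?thesis
        using has_real_derivative_at_of_half_line[OF der] pos by (meson less_imp_le)
    qed
    show "continuous_on {s..t} f"
      by (rule continuous_on_subset[OF continuous_on_half_line[OF der]]) (use st \<open>0 \<le> T\<close> in auto)
  qed
qed

text \<open>\<open>V t * exp (- (k * t))\<close> has nonpositive derivative. The rate
  \<open>k\<close> may have either sign: positive for growth bounds, negative for decay; applying it
  to -V gives lower bounds.\<close>

lemma differential_gronwall:
  fixes V :: "real \<Rightarrow> real"
  assumes der: "\<And>t. 0 \<le> t \<Longrightarrow> (V has_real_derivative V' t) (at t within {0..})"
    and le: "\<And>t. 0 \<le> t \<Longrightarrow> V' t \<le> k * V t" and "0 \<le> t"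
  shows "V t \<le> V 0 * exp (k * t)"
proof -
  have "V t * exp (- (k * t)) \<le> V 0 * exp (- (k * 0))"
  proof (rule nonincreasing_half_line[where f = "\<lambda>t. V t * exp (- (k * t))" and f' = "\<lambda>t. (V' t - k * V t) * exp (- (k * t))"])
    show "((\<lambda>t. V t * exp (- (k * t))) has_real_derivative (V' t - k * V t) * exp (- (k * t)))
        (at t within {0..})" if "0 \<le> t" for t
      using der[OF that] by (auto intro!: derivative_eq_intros simp: algebra_simps)
    show "(V' t - k * V t) * exp (- (k * t)) \<le> 0" if "0 \<le> t" for t
      using le[OF that] by (simp add: mult_nonpos_nonneg)
  qed (use \<open>0 \<le> t\<close> in auto)
  then show ?thesis by (simp add: exp_minus field_simps)
qed

text \<open>Intermediate value theorem. It serves to turn equilibria, which a non-equilibrium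
  solution never hits, into barriers.\<close>

lemma below_if_avoids:
  fixes z :: "real \<Rightarrow> real"
  assumes "continuous_on {0..} z" "\<And>t. 0 \<le> t \<Longrightarrow> z t \<noteq> p" "z 0 < p" "0 \<le> t"
  shows "z t < p"
proof (rule ccontr)
  assume "\<not> z t < p"
  moreover have "continuous_on {0..t} z"
    by (rule continuous_on_subset[OF assms(1)]) auto
  ultimately obtain x where "0 \<le> x" "z x = p"
    using IVT'[of z 0 p t] assms by auto
  then show False using assms(2) by blast
qed

lemma above_if_avoids:
  fixes z :: "real \<Rightarrow> real"
  assumes "continuous_on {0..} z" "\<And>t. 0 \<le> t \<Longrightarrow> z t \<noteq> p" "p < z 0" "0 \<le> t"
  shows "p < z t"
  using below_if_avoids[of "\<lambda>t. - z t" "- p" t] assms by (auto intro: continuous_on_minus)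

lemma exp_decay_tendsto_0:
  fixes c A :: real
  assumes "c > 0"
  shows "((\<lambda>t. A * exp (- c * t)) \<longlongrightarrow> 0) at_top"
proof -
  have "((\<lambda>t. A * exp (- c * t)) \<longlongrightarrow> A * 0) at_top"
    using assms by (intro tendsto_mult tendsto_const filterlim_compose[OF exp_at_bot]
      filterlim_tendsto_neg_mult_at_bot[OF tendsto_const] filterlim_ident) auto
  then show ?thesis by simp
qed

text \<open>The increment after time u is at most the integral of the bound over [u, \<infinity>),
  which is \<open>C / c * exp (- c * u)\<close>. Completeness then yields the limit, and the same
  tail bounds the distance to it.\<close>

lemma exponentially_small_derivative_imp_limit:
  fixes s :: "real \<Rightarrow> 'a::banach"
  assumes der: "\<And>t. 0 \<le> t \<Longrightarrow> (s has_vector_derivative s' t) (at t within {0..})"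
    and bound: "\<And>t. 0 \<le> t \<Longrightarrow> norm (s' t) \<le> C * exp (- c * t)" and "c > 0"
  shows "\<exists>L. \<forall>t\<ge>0. norm (s t - L) \<le> C / c * exp (- c * t)"
proof -
  have C: "C \<ge> 0" using norm_ge_zero[of "s' 0"] bound[of 0] by (simp del: norm_ge_zero)
  have incr: "norm (s v - s u) \<le> C / c * exp (- c * u)" if "0 \<le> u" "u \<le> v" for u v
  proof (cases "u = v")
    case True
    then show ?thesis using C \<open>c > 0\<close> by simp
  next
    case False
    with that have "u < v" by simp
    \<comment> \<open>Mean value inequality against \<open>- (C / c) * exp (- c * t)\<close>, an
      antiderivative of the bound on the speed.\<close>
    have "norm (s v - s u) \<le> (- (C / c) * exp (- c * v)) - (- (C / c) * exp (- c * u))"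
    proof (rule differentiable_bound_general[OF \<open>u < v\<close>])
      show "continuous_on {u..v} s"
        by (rule continuous_on_subset[of "{0..}"])
          (use der that in \<open>auto simp: continuous_on_eq_continuous_within
             intro!: has_vector_derivative_continuous\<close>)
      show "continuous_on {u..v} (\<lambda>t. - (C / c) * exp (- c * t))"
        by (intro continuous_intros)
      fix x assume x: "u < x" "x < v"
      show "(s has_vector_derivative s' x) (at x)"
      proof -
        have "at x within {0..} = at x"
          using x that by (intro at_within_interior) auto
        then show ?thesis using der[of x] x that by simp
      qed
      show "((\<lambda>t. - (C / c) * exp (- c * t)) has_vector_derivative C * exp (- c * x)) (at x)"
        unfolding has_real_derivative_iff_has_vector_derivative[symmetric]
        using \<open>c > 0\<close> by (auto intro!: derivative_eq_intros)
      show "norm (s' x) \<le> C * exp (- c * x)" using bound x that by simp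
    qed
    also have "\<dots> \<le> C / c * exp (- c * u)" using C \<open>c > 0\<close> by simp
    finally show ?thesis .
  qed
  have lim0: "(\<lambda>m. C / c * exp (- c * real m)) \<longlonglongrightarrow> 0"
    using filterlim_compose[OF exp_decay_tendsto_0[OF \<open>c > 0\<close>] filterlim_real_sequentially] .
  \<comment> \<open>Integer times suffice to produce the limit L; real times are covered afterwards
    by letting m tend to infinity in the increment bound with u = t.\<close>
  have "Cauchy (\<lambda>m. s (real m))"
  proof (rule CauchyI')
    fix e :: real assume "e > 0"
    then obtain M where M: "\<And>m. m \<ge> M \<Longrightarrow> C / c * exp (- c * real m) < e"
      using order_tendstoD(2)[OF lim0] by (auto simp: eventually_sequentially)
    show "\<exists>M. \<forall>m\<ge>M. \<forall>k>m. dist (s (real m)) (s (real k)) < e"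
    proof (intro exI[of _ M] allI impI)
      fix m k assume "M \<le> m" "m < k"
      then have "norm (s (real k) - s (real m)) \<le> C / c * exp (- c * real m)"
        by (intro incr) auto
      then show "dist (s (real m)) (s (real k)) < e"
        using M[OF \<open>M \<le> m\<close>] unfolding dist_norm norm_minus_commute[of "s (real m)"] by linarith
    qed
  qed
  then obtain L where L: "(\<lambda>m. s (real m)) \<longlonglongrightarrow> L"
    using Cauchy_convergent convergent_def by blast
  have "norm (s t - L) \<le> C / c * exp (- c * t)" if "t \<ge> 0" for t
  proof (rule tendsto_upperbound)
    show "(\<lambda>m. norm (s t - s (real m))) \<longlonglongrightarrow> norm (s t - L)"
      by (intro tendsto_intros L)
    show "\<forall>\<^sub>F m in sequentially. norm (s t - s (real m)) \<le> C / c * exp (- c * t)"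
      using eventually_ge_at_top[of "nat \<lceil>t\<rceil>"]
      by eventually_elim (use incr that in \<open>auto simp: norm_minus_commute\<close>)
  qed simp
  then show ?thesis by blast
qed

section \<open>The scalar orientation dynamics\<close>

text \<open>By concavity on [0, pi], the sine lies above its chord from 0 to b; x has weight
  \<open>x / b\<close> on that chord.\<close>

lemma sin_ge_chord:
  assumes "0 \<le> x" "x \<le> b" "0 < b" "b \<le> pi"
  shows "sin b / b * x \<le> sin (x::real)"
proof -
  have "convex_on {0..pi} (\<lambda>x. - sin x :: real)"
  proof (rule f''_ge0_imp_convex[where f' = "\<lambda>x. - cos x" and f'' = sin])
    show "((\<lambda>x. - sin x) has_real_derivative - cos x) (at x)" for x :: real
      by (auto intro!: derivative_eq_intros)
    show "((\<lambda>x. - cos x) has_real_derivative sin x) (at x)" for x :: real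
      by (auto intro!: derivative_eq_intros)
  qed (auto intro: sin_ge_zero)
  from convex_onD[OF this, of "x / b" 0 b] assms show ?thesis
    by (simp add: mult.commute)
qed

text \<open>Both sides are even in x, so the chord bound at |x| suffices. It makes the dissipation
  in the Lyapunov estimate quadratic.\<close>

lemma mult_sin_ge:
  assumes "\<bar>x\<bar> \<le> b" "0 < b" "b < pi"
  shows "sin b / b * x\<^sup>2 \<le> x * sin (x::real)"
proof -
  have "sin b / b * \<bar>x\<bar> \<le> sin \<bar>x\<bar>" using assms by (intro sin_ge_chord) auto
  then have "\<bar>x\<bar> * (sin b / b * \<bar>x\<bar>) \<le> \<bar>x\<bar> * sin \<bar>x\<bar>"
    by (rule mult_left_mono) simp
  moreover have "\<bar>x\<bar> * sin \<bar>x\<bar> = x * sin x" by (auto simp: abs_if)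
  moreover have "\<bar>x\<bar> * (sin b / b * \<bar>x\<bar>) = sin b / b * x\<^sup>2"
    by (metis mult.left_commute power2_abs power2_eq_square)
  ultimately show ?thesis by (simp only:)
qed

text \<open>In the product formula for \<open>cos x - cos s\<close> the factor
  \<open>sin ((x + s) / 2)\<close> is positive on the whole interval (-s, 2 pi - s), so
  \<open>sin ((s - x) / 2)\<close> decides the sign. For the dynamics this makes s attracting from
  both sides.\<close>

lemma cos_diff_sign:
  fixes s x :: real
  assumes "0 < s" "s < pi" "- s < x" "x < 2 * pi - s"
  shows "x < s \<Longrightarrow> cos s < cos x" and "s < x \<Longrightarrow> cos x < cos s"
proof -
  have eq: "cos x - cos s = 2 * sin ((x + s) / 2) * sin ((s - x) / 2)"
    by (rule cos_diff_cos)
  have p: "0 < sin ((x + s) / 2)" using assms by (intro sin_gt_zero) auto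
  show "cos s < cos x" if "x < s"
  proof -
    have "0 < sin ((s - x) / 2)" using that assms by (intro sin_gt_zero) auto
    then show ?thesis using eq mult_pos_pos[OF p, of "sin ((s - x) / 2)"] by simp
  qed
  show "cos x < cos s" if "s < x"
  proof -
    have "0 < sin ((x - s) / 2)" using that assms by (intro sin_gt_zero) auto
    moreover have "sin ((s - x) / 2) = - sin ((x - s) / 2)"
      by (metis minus_diff_eq minus_divide_left sin_minus)
    ultimately show ?thesis using eq mult_pos_pos[OF p, of "sin ((x - s) / 2)"] by simp
  qed
qed

text \<open>\<open>V = (cos z - b)^2\<close> satisfies V' = -2 a sin(z) V, so V stays between V(0)
  exp(-2at) and V(0) exp(2at): it vanishes at time t exactly when it vanishes at 0. This stands in
  for uniqueness of solutions at an equilibrium.\<close>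

lemma cos_dynamics_dichotomy:
  fixes z :: "real \<Rightarrow> real"
  assumes "a > 0"
    and der: "\<And>t. 0 \<le> t \<Longrightarrow> (z has_real_derivative a * (cos (z t) - b)) (at t within {0..})"
    and "0 \<le> t"
  shows "cos (z t) = b \<longleftrightarrow> cos (z 0) = b"
proof -
  define V where "V t = (cos (z t) - b)\<^sup>2" for t
  define V' where "V' t = - 2 * a * sin (z t) * V t" for t
  have dV: "(V has_real_derivative V' t) (at t within {0..})" if "0 \<le> t" for t
    unfolding V_def V'_def
    by (rule derivative_eq_intros der that refl | simp add: power2_eq_square)+
  have V0: "V t \<ge> 0" for t by (simp add: V_def)
  have ub: "V' t \<le> 2 * a * V t" and lb: "- V' t \<le> 2 * a * V t" for t
  proof -
    have "- sin (z t) * (2 * a * V t) \<le> 1 * (2 * a * V t)" "sin (z t) * (2 * a * V t) \<le> 1 * (2 * a * V t)"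
      using V0[of t] \<open>a > 0\<close> sin_ge_minus_one[of "z t"] by (intro mult_right_mono; simp)+
    then show "V' t \<le> 2 * a * V t" "- V' t \<le> 2 * a * V t" by (auto simp: V'_def algebra_simps)
  qed
  have "V t \<le> V 0 * exp (2 * a * t)"
    by (rule differential_gronwall[OF dV ub \<open>0 \<le> t\<close>])
  \<comment> \<open>The lower bound is Gronwall for -V with the negative rate -2a.\<close>
  moreover have "- V t \<le> - V 0 * exp (- (2 * a) * t)"
    by (rule differential_gronwall[where V' = "\<lambda>t. - V' t"])
      (use dV lb \<open>0 \<le> t\<close> in \<open>auto intro!: derivative_intros\<close>)
  ultimately have "V t = 0 \<longleftrightarrow> V 0 = 0"
    using V0[of t] V0[of 0]
    by (smt (verit) exp_gt_zero mult_pos_pos mult_minus_left mult_eq_0_iff)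
  then show ?thesis by (simp add: V_def)
qed

text \<open>The equilibria -s and 2 pi - s act as barriers, so z moves monotonically from
  \<open>z 0\<close> towards s without reaching it. On the segment between them the product formula
  bounds the pull towards s below by a multiple of |z - s|, and the Lyapunov function
  \<open>(z - s)^2\<close> decays exponentially.\<close>

lemma cos_dynamics_convergence:
  fixes z :: "real \<Rightarrow> real"
  assumes a: "a > 0" and s: "0 < s" "s < pi"
    and der: "\<And>t. 0 \<le> t \<Longrightarrow> (z has_real_derivative a * (cos (z t) - cos s)) (at t within {0..})"
    and init: "- s < z 0" "z 0 < 2 * pi - s" "z 0 \<noteq> s"
  shows "strict_mono_on {0..} z \<or> strict_antimono_on {0..} z"
    and "\<exists>c>0. \<forall>t\<ge>0. \<bar>z t - s\<bar> \<le> \<bar>z 0 - s\<bar> * exp (- c * t)"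
proof -
  have "cos (z 0) \<noteq> cos s" using cos_diff_sign[OF s init(1,2)] init(3) by fastforce
  then have ne: "cos (z t) \<noteq> cos s" if "0 \<le> t" for t
    using cos_dynamics_dichotomy[OF a der that] by blast
  \<comment> \<open>All three points have cosine \<open>cos s\<close>.\<close>
  have avoid: "z t \<noteq> - s" "z t \<noteq> s" "z t \<noteq> 2 * pi - s" if "0 \<le> t" for t
    using ne[OF that] by (auto simp: cos_diff)
  note cont = continuous_on_half_line[OF der]
  have in1: "- s < z t" "z t < 2 * pi - s" if "0 \<le> t" for t
    using above_if_avoids[OF cont avoid(1) init(1) that] below_if_avoids[OF cont avoid(3) init(2) that]
    by auto
  define lo hi where "lo = min (z 0) s" and "hi = max (z 0) s"
  have key: "(strict_mono_on {0..} z \<or> strict_antimono_on {0..} z) \<and> (\<forall>t\<ge>0. lo \<le> z t \<and> z t \<le> hi)"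
  proof (cases "z 0 < s")
    case True
    have below: "z t < s" if "0 \<le> t" for t
      using below_if_avoids[OF cont avoid(2) True that] .
    have mono: "strict_mono_on {0..} z"
      by (rule strict_mono_on_half_line[OF der])
        (use a cos_diff_sign(1)[OF s in1 below] in auto)
    have "z 0 \<le> z t" if "0 \<le> t" for t
      using strict_mono_onD[OF mono, of 0 t] that by (cases "t = 0") auto
    with mono below True show ?thesis by (auto simp: lo_def hi_def less_imp_le)
  next
    case False
    then have gt: "s < z 0" using init by simp
    have above: "s < z t" if "0 \<le> t" for t
      using above_if_avoids[OF cont avoid(2) gt that] .
    have "strict_mono_on {0..} (\<lambda>t. - z t)"
    proof (rule strict_mono_on_half_line[where f' = "\<lambda>t. - (a * (cos (z t) - cos s))"])
      show "0 < - (a * (cos (z t) - cos s))" if "0 \<le> t" for t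
        using a cos_diff_sign(2)[OF s in1[OF that] above[OF that]] by (simp add: mult_pos_neg)
    qed (use der in \<open>auto intro!: derivative_intros\<close>)
    then have anti: "strict_antimono_on {0..} z"
      by (auto simp: monotone_on_def)
    have "z t \<le> z 0" if "0 \<le> t" for t
      using monotone_onD[OF anti, of 0 t] that by (cases "t = 0") auto
    with anti above gt show ?thesis by (auto simp: lo_def hi_def less_imp_le)
  qed
  then show "strict_mono_on {0..} z \<or> strict_antimono_on {0..} z" by blast
  \<comment> \<open>The sine rises and then falls on [0, pi], so its minimum over a segment there is
    attained at an endpoint. Both endpoints lie strictly inside (0, pi), hence m > 0.\<close>
  define m where "m = min (sin ((lo + s) / 2)) (sin ((hi + s) / 2))"
  define B where "B = \<bar>z 0 - s\<bar> / 2"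
  have B: "0 < B" "B < pi" using init s by (auto simp: B_def)
  have "m > 0" unfolding m_def lo_def hi_def
    using init s by (auto simp: min_def max_def intro!: sin_gt_zero)
  have sin_ge: "m \<le> sin ((x + s) / 2)" if "lo \<le> x" "x \<le> hi" for x
  proof -
    have "lo > - s" "hi < 2 * pi - s" using init s by (auto simp: lo_def hi_def)
    show ?thesis
    proof (cases "(x + s) / 2 \<le> pi / 2")
      case True
      then have "sin ((lo + s) / 2) \<le> sin ((x + s) / 2)"
        using that \<open>lo > - s\<close> by (intro sin_monotone_2pi_le) auto
      then show ?thesis by (simp add: m_def)
    next
      case False
      \<comment> \<open>Reflection at pi/2 turns the falling branch into the rising one.\<close>
      then have "sin (pi - (hi + s) / 2) \<le> sin (pi - (x + s) / 2)"
        using that \<open>hi < 2 * pi - s\<close> by (intro sin_monotone_2pi_le) (auto simp: field_simps)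
      then show ?thesis by (simp add: m_def)
    qed
  qed
  \<comment> \<open>With w = (z - s)/2 and S = sin((z + s)/2) one has V' = -8 a S w sin w. Since S
    \<ge> m, w sin w \<ge> (sin B / B) w^2 and V = 4 w^2, this gives V' \<le> -2cV.\<close>
  define c where "c = a * m * (sin B / B)"
  have "c > 0" unfolding c_def using a \<open>m > 0\<close> B sin_gt_zero by simp
  define V where "V t = (z t - s)\<^sup>2" for t
  have V_le: "V t \<le> V 0 * exp (- (2 * c) * t)" if "0 \<le> t" for t
  proof (rule differential_gronwall[OF _ _ that])
    show "(V has_real_derivative 2 * (z t - s) * (a * (cos (z t) - cos s))) (at t within {0..})"
      if "0 \<le> t" for t unfolding V_def
      by (rule derivative_eq_intros der that refl | simp)+
    show "2 * (z t - s) * (a * (cos (z t) - cos s)) \<le> - (2 * c) * V t" if "0 \<le> t" for t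
    proof -
      define w S where "w = (z t - s) / 2" and "S = sin ((z t + s) / 2)"
      have zt: "lo \<le> z t" "z t \<le> hi" using key that by auto
      have "\<bar>w\<bar> \<le> B" using zt by (auto simp: w_def B_def lo_def hi_def split: if_splits)
      then have w: "sin B / B * w\<^sup>2 \<le> w * sin w" using B by (rule mult_sin_ge)
      have "0 \<le> sin B / B * w\<^sup>2" using B sin_gt_zero by (simp add: less_imp_le)
      then have "m * (sin B / B * w\<^sup>2) \<le> S * (w * sin w)"
        using mult_mono[OF sin_ge[OF zt] w] sin_ge[OF zt] \<open>m > 0\<close> unfolding S_def by linarith
      then have "8 * a * (m * (sin B / B * w\<^sup>2)) \<le> 8 * a * (S * (w * sin w))"
        using a by (intro mult_left_mono) auto
      moreover have cos_eq: "cos (z t) - cos s = - 2 * S * sin w"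
      proof -
        have "sin ((s - z t) / 2) = - sin w"
          unfolding w_def by (metis minus_diff_eq minus_divide_left sin_minus)
        then show ?thesis using cos_diff_cos[of "z t" s] by (simp add: S_def)
      qed
      moreover have z_eq: "z t - s = 2 * w" by (simp add: w_def)
      ultimately show ?thesis
        unfolding V_def c_def cos_eq z_eq by (simp add: power2_eq_square algebra_simps)
    qed
  qed
  have "\<bar>z t - s\<bar> \<le> \<bar>z 0 - s\<bar> * exp (- c * t)" if "0 \<le> t" for t
  proof (rule power2_le_imp_le)
    have "(exp (- c * t))\<^sup>2 = exp (- (2 * c) * t)"
      by (simp add: power2_eq_square flip: exp_add)
    then show "\<bar>z t - s\<bar>\<^sup>2 \<le> (\<bar>z 0 - s\<bar> * exp (- c * t))\<^sup>2"
      using V_le[OF that] by (simp add: V_def power_mult_distrib)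
  qed simp
  with \<open>c > 0\<close> show "\<exists>c>0. \<forall>t\<ge>0. \<bar>z t - s\<bar> \<le> \<bar>z 0 - s\<bar> * exp (- c * t)" by blast
qed

section \<open>Plane geometry\<close>

lemma evec_nth [simp]: "evec \<theta> $ 1 = cos \<theta>" "evec \<theta> $ 2 = sin \<theta>"
  by (simp_all add: evec_def)

lemma inner_evec: "evec \<alpha> \<bullet> evec \<beta> = cos (\<alpha> - \<beta>)"
  by (simp add: inner_vec_def sum_2 cos_diff)

lemma norm_evec [simp]: "norm (evec \<theta>) = 1"
  by (simp add: norm_eq_sqrt_inner inner_evec)

text \<open>A chord of the unit circle is no longer than its arc: its square is 4 sin^2 of half the
  angle.\<close>

lemma norm_evec_diff_le: "norm (evec \<alpha> - evec \<beta>) \<le> \<bar>\<alpha> - \<beta>\<bar>"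
proof (rule power2_le_imp_le)
  have "cos (\<beta> - \<alpha>) = cos (\<alpha> - \<beta>)" by (metis cos_minus minus_diff_eq)
  then have "(norm (evec \<alpha> - evec \<beta>))\<^sup>2 = 2 - 2 * cos (\<alpha> - \<beta>)"
    by (simp add: power2_norm_eq_inner inner_diff inner_evec)
  also have "cos (\<alpha> - \<beta>) = 1 - 2 * (sin ((\<alpha> - \<beta>) / 2))\<^sup>2"
    by (metis cos_double_sin field_sum_of_halves mult_2)
  also have "2 - 2 * \<dots> = 4 * (sin ((\<alpha> - \<beta>) / 2))\<^sup>2" by simp
  also have "\<dots> \<le> 4 * ((\<alpha> - \<beta>) / 2)\<^sup>2"
    using iffD1[OF abs_le_square_iff abs_sin_x_le_abs_x] by (rule mult_left_mono) simp
  also have "\<dots> = \<bar>\<alpha> - \<beta>\<bar>\<^sup>2" by (simp add: power2_eq_square)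
  finally show "(norm (evec \<alpha> - evec \<beta>))\<^sup>2 \<le> \<bar>\<alpha> - \<beta>\<bar>\<^sup>2" .
qed simp

lemma linear_field_eq_inner: "linear_field n \<phi> D0 p = n * (p \<bullet> evec \<phi>) + D0"
  by (simp add: linear_field_def inner_vec_def sum_2)

lemma GDERIV_linear_field: "GDERIV (linear_field n \<phi> D0) p :> n *\<^sub>R evec \<phi>"
  unfolding gderiv_def linear_field_eq_inner[abs_def]
  by (auto intro!: derivative_eq_intros)

section \<open>The closed loop\<close>

lemma closed_loop_orientation_constant:
  assumes "n > 0" "vbar > 0" "cos (\<alpha> - \<phi>) = cos \<theta>star" "0 \<le> \<theta>star" "\<theta>star \<le> pi"
    and \<nu>: "\<nu> = vbar * n * cos \<theta>star"
    and D: "D = linear_field n \<phi> D0"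
    and cl: "closed_loop D vbar \<mu> \<nu> dstar rin r \<theta> d"
    and const: "\<And>t. 0 \<le> t \<Longrightarrow> \<theta> t = \<alpha>"
  shows "straight_motion D vbar \<theta>star \<nu> r d"
proof -
  have r: "r t = r 0 + (vbar * t) *\<^sub>R evec \<alpha>" if "0 \<le> t" for t
  proof -
    \<comment> \<open>Subtracting the uniform motion leaves a curve with zero derivative.\<close>
    have "r t - (vbar * t) *\<^sub>R evec \<alpha> = r 0 - (vbar * 0) *\<^sub>R evec \<alpha>"
    proof (rule has_derivative_zero_unique[of "{0..}" "\<lambda>t. r t - (vbar * t) *\<^sub>R evec \<alpha>"])
      fix u :: real assume "u \<in> {0..}"
      then have "(r has_vector_derivative vbar *\<^sub>R evec \<alpha>) (at u within {0..})"
        using cl const by (auto simp: closed_loop_def)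
      then have "((\<lambda>t. r t - (vbar * t) *\<^sub>R evec \<alpha>) has_vector_derivative 0) (at u within {0..})"
        by (auto intro!: derivative_eq_intros)
      then show "((\<lambda>t. r t - (vbar * t) *\<^sub>R evec \<alpha>) has_derivative (\<lambda>h. 0)) (at u within {0..})"
        by (simp add: has_vector_derivative_def)
    qed (use that in auto)
    then show ?thesis by (simp add: algebra_simps)
  qed
  have "vec_angle (evec \<alpha>) (n *\<^sub>R evec \<phi>) = \<theta>star"
    using assms(1-5) by (simp add: vec_angle_def inner_evec arccos_cos)
  moreover have "(d has_real_derivative \<nu>) (at t within {0..})" if "0 \<le> t" for t
  \<comment> \<open>On the half-line the field value is affine with slope vbar n cos(\<alpha> -
    \<phi>) = \<nu>. The \<open>d = 1\<close> is the rule's neighbourhood radius, an arbitrary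
    choice, and not the field value.\<close>
  proof (rule has_field_derivative_transform_within[where f = "\<lambda>t. D (r 0) + \<nu> * t" and d = 1])
    show "((\<lambda>t. D (r 0) + \<nu> * t) has_real_derivative \<nu>) (at t within {0..})"
      by (auto intro!: derivative_eq_intros)
    show "D (r 0) + \<nu> * u = d u" if "u \<in> {0..}" for u
    proof -
      have "d u = D (r u)" using cl that by (simp add: closed_loop_def)
      also have "\<dots> = D (r 0) + \<nu> * u"
        using r[of u] that assms(3)
        by (simp add: D linear_field_eq_inner \<nu> inner_add_left inner_evec algebra_simps)
      finally show ?thesis by simp
    qed
  qed (use that in auto)
  ultimately show ?thesis
    unfolding straight_motion_def using r GDERIV_linear_field D norm_evec by metis
qed

lemma closed_loop_field_derivative:
  assumes "closed_loop (linear_field n \<phi> D0) vbar \<mu> \<nu> dstar rin r \<theta> d" "0 \<le> t"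
  shows "(d has_real_derivative vbar * n * cos (\<theta> t - \<phi>)) (at t within {0..})"
proof (rule has_field_derivative_transform_within[where f = "\<lambda>t. n * (r t \<bullet> evec \<phi>) + D0" and d = 1])
  have "(r has_vector_derivative vbar *\<^sub>R evec (\<theta> t)) (at t within {0..})"
    using assms by (auto simp: closed_loop_def)
  then show "((\<lambda>t. n * (r t \<bullet> evec \<phi>) + D0) has_real_derivative vbar * n * cos (\<theta> t - \<phi>))
      (at t within {0..})"
    unfolding has_vector_derivative_def has_field_derivative_def
    by (auto intro!: derivative_eq_intros simp: inner_evec fun_eq_iff)
qed (use assms in \<open>auto simp: closed_loop_def linear_field_eq_inner\<close>)

text \<open>The gradient is constant, so differentiating the feedback law leaves only \<theta> on
  the right: the position drops out and the equation is autonomous.\<close>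

lemma closed_loop_orientation_derivative:
  assumes "closed_loop (linear_field n \<phi> D0) vbar \<mu> \<nu> dstar rin r \<theta> d" "0 \<le> t"
  shows "(\<theta> has_real_derivative \<mu> * (vbar * n * cos (\<theta> t - \<phi>) - \<nu>)) (at t within {0..})"
proof (rule has_field_derivative_transform_within[where f = "\<lambda>t. \<mu> * (d t - \<nu> * t - dstar)" and d = 1])
  show "((\<lambda>t. \<mu> * (d t - \<nu> * t - dstar)) has_real_derivative
      \<mu> * (vbar * n * cos (\<theta> t - \<phi>) - \<nu>)) (at t within {0..})"
    by (rule derivative_eq_intros closed_loop_field_derivative[OF assms] refl | simp)+
qed (use assms in \<open>auto simp: closed_loop_def\<close>)

text \<open>Supplies the limiting trajectory. Along the line D grows at rate \<nu>, cancelling the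
  term \<open>\<nu> * t\<close> of the feedback law, so the law holds at all times once it holds at
  p.\<close>

lemma closed_loop_straight_line:
  assumes "cos (\<alpha> - \<phi>) = cos \<theta>star" "\<nu> = vbar * n * cos \<theta>star"
    and "\<alpha> = \<mu> * (linear_field n \<phi> D0 p - dstar)"
  shows "closed_loop (linear_field n \<phi> D0) vbar \<mu> \<nu> dstar p (\<lambda>t. p + (vbar * t) *\<^sub>R evec \<alpha>)
           (\<lambda>t. \<alpha>) (\<lambda>t. linear_field n \<phi> D0 (p + (vbar * t) *\<^sub>R evec \<alpha>))"
proof -
  have "((\<lambda>t. p + (vbar * t) *\<^sub>R evec \<alpha>) has_vector_derivative vbar *\<^sub>R evec \<alpha>) (at t within {0..})"
    for t by (auto intro!: derivative_eq_intros)
  moreover have "linear_field n \<phi> D0 (p + (vbar * t) *\<^sub>R evec \<alpha>) = linear_field n \<phi> D0 p + \<nu> * t" for t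
    using assms(1) by (simp add: linear_field_eq_inner inner_add_left inner_evec assms(2) algebra_simps)
  ultimately show ?thesis using assms(3) by (simp add: closed_loop_def)
qed

text \<open>In the frame moving with velocity vbar e(\<alpha>) the robot has exponentially small
  speed and converges to some p. Passing to the limit in the feedback law shows that starting at p
  gives exactly \<alpha>, not merely \<alpha> modulo 2 pi.\<close>

lemma closed_loop_limit_point:
  assumes cl: "closed_loop (linear_field n \<phi> D0) vbar \<mu> \<nu> dstar rin r \<theta> d"
    and "cos (\<alpha> - \<phi>) = cos \<theta>star" "\<nu> = vbar * n * cos \<theta>star" "vbar > 0" "c > 0"
    and conv: "\<And>t. 0 \<le> t \<Longrightarrow> \<bar>\<theta> t - \<alpha>\<bar> \<le> K * exp (- c * t)"
  shows "\<exists>p. \<alpha> = \<mu> * (linear_field n \<phi> D0 p - dstar) \<and>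
             (\<forall>t\<ge>0. norm (r t - (p + (vbar * t) *\<^sub>R evec \<alpha>)) \<le> vbar * K / c * exp (- c * t))"
proof -
  define s where "s t = r t - (vbar * t) *\<^sub>R evec \<alpha>" for t
  have ds: "(s has_vector_derivative vbar *\<^sub>R (evec (\<theta> t) - evec \<alpha>)) (at t within {0..})"
    if "0 \<le> t" for t
  proof -
    have "(r has_vector_derivative vbar *\<^sub>R evec (\<theta> t)) (at t within {0..})"
      using cl that by (auto simp: closed_loop_def)
    then show ?thesis unfolding s_def
      by (auto intro!: derivative_eq_intros simp: algebra_simps)
  qed
  have "norm (vbar *\<^sub>R (evec (\<theta> t) - evec \<alpha>)) \<le> vbar * K * exp (- c * t)" if "0 \<le> t" for t
    using order_trans[OF norm_evec_diff_le conv[OF that]] \<open>vbar > 0\<close> by simp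
  from exponentially_small_derivative_imp_limit[OF ds this \<open>c > 0\<close>]
  obtain p where p: "\<And>t. 0 \<le> t \<Longrightarrow> norm (s t - p) \<le> vbar * K / c * exp (- c * t)"
    by blast
  note e0 = exp_decay_tendsto_0[OF \<open>c > 0\<close>]
  have "(s \<longlongrightarrow> p) at_top"
    by (rule LIM_zero_cancel, rule Lim_null_comparison[OF _ e0[of "vbar * K / c"]])
      (rule eventually_mono[OF eventually_ge_at_top[of 0]], use p in simp)
  then have "((\<lambda>t. \<mu> * (n * (s t \<bullet> evec \<phi>) + D0 - dstar)) \<longlongrightarrow>
      \<mu> * (n * (p \<bullet> evec \<phi>) + D0 - dstar)) at_top"
    by (intro tendsto_intros)
  \<comment> \<open>Replacing r by s removes exactly the term \<open>\<nu> * t\<close>, because vbar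
    n cos(\<alpha> - \<phi>) = \<nu>; the law becomes time-free.\<close>
  moreover have "\<forall>\<^sub>F t in at_top. \<mu> * (n * (s t \<bullet> evec \<phi>) + D0 - dstar) = \<theta> t"
    using eventually_ge_at_top[of 0]
  proof eventually_elim
    case (elim t)
    then have "\<theta> t = \<mu> * (linear_field n \<phi> D0 (r t) - \<nu> * t - dstar)"
      using cl by (auto simp: closed_loop_def)
    then show ?case using assms(2,3)
      by (simp add: s_def linear_field_eq_inner inner_diff_left inner_evec algebra_simps)
  qed
  ultimately have "(\<theta> \<longlongrightarrow> \<mu> * (n * (p \<bullet> evec \<phi>) + D0 - dstar)) at_top"
    by (rule Lim_transform_eventually)
  moreover have "(\<theta> \<longlongrightarrow> \<alpha>) at_top"
    by (rule LIM_zero_cancel, rule Lim_null_comparison[OF _ e0[of K]])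
      (rule eventually_mono[OF eventually_ge_at_top[of 0]], use conv in simp)
  ultimately have "\<alpha> = \<mu> * (linear_field n \<phi> D0 p - dstar)"
    unfolding linear_field_eq_inner using tendsto_unique[OF trivial_limit_at_top_linorder] by blast
  then show ?thesis using p by (auto simp: s_def algebra_simps)
qed

theorem theorem3p1:
  fixes n \<phi> D0 vbar \<mu> dstar \<nu> :: real
    and D :: "real ^ 2 \<Rightarrow> real"
    and \<theta>star :: real
    and rin :: "real ^ 2"
    and r :: "real \<Rightarrow> real ^ 2" and \<theta> d :: "real \<Rightarrow> real"
  assumes "n > 0" and "vbar > 0" and "\<mu> > 0" and "0 < \<nu>" and "\<nu> < vbar * n"
    and "D = linear_field n \<phi> D0"
    and "\<theta>star = theta_star vbar n \<nu>"
    and "closed_loop D vbar \<mu> \<nu> dstar rin r \<theta> d"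
  shows
    "(cond_P D \<mu> dstar \<phi> \<theta>star rin \<longrightarrow> straight_motion D vbar \<theta>star \<nu> r d) \<and>
     (\<not> cond_P D \<mu> dstar \<phi> \<theta>star rin \<longrightarrow>
        (\<exists>rin' r' \<theta>' d' (k::int).
            closed_loop D vbar \<mu> \<nu> dstar rin' r' \<theta>' d' \<and>
            cond_P D \<mu> dstar \<phi> \<theta>star rin' \<and>
            straight_motion D vbar \<theta>star \<nu> r' d' \<and>
            (\<forall>t\<ge>0. \<theta>' t = \<phi> + \<theta>star + 2 * pi * of_int k) \<and>
            (\<exists>C c. c > 0 \<and>
               (\<forall>t\<ge>0. norm (r t - r' t) \<le> C * exp (- c * t) \<and>
                      \<bar>\<theta> t - \<theta>' t\<bar> \<le> C * exp (- c * t)))) \<and>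
        (\<exists>T\<ge>0. strict_mono_on {T..} d) \<and>
        (\<exists>ddot. (\<forall>t\<ge>0. (d has_real_derivative ddot t) (at t within {0..})) \<and>
              (ddot \<longlongrightarrow> \<nu>) at_top) \<and>
        (strict_mono_on {0..} \<theta> \<or> strict_antimono_on {0..} \<theta>) \<and>
        (\<exists>\<theta>inf. (\<theta> \<longlongrightarrow> \<theta>inf) at_top \<and> \<bar>\<theta>inf - \<theta> 0\<bar> < 2 * pi))"
proof -

  \<comment> \<open>Reduction to the scalar equation\<close>
  note D = assms(6)
  have cl: "closed_loop (linear_field n \<phi> D0) vbar \<mu> \<nu> dstar rin r \<theta> d"
    using assms(8) D by simp
  have ratio: "0 < \<nu> / (vbar * n)" "\<nu> / (vbar * n) < 1" using assms(1-5) by auto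
  have s: "0 < \<theta>star" "\<theta>star < pi" and cos_s: "cos \<theta>star = \<nu> / (vbar * n)"
    using ratio arccos_lt_bounded[of "\<nu> / (vbar * n)"]
    by (auto simp: assms(7) theta_star_def)
  have \<nu>: "\<nu> = vbar * n * cos \<theta>star" using assms(1,2) cos_s by simp
  define a where "a = \<mu> * vbar * n"
  have a: "a > 0" using assms(1-3) by (simp add: a_def)
  \<comment> \<open>The shift moves the equilibria \<phi> \<plusminus> \<theta>star + 2 pi k to
    \<plusminus> \<theta>star.\<close>
  define z where "z k t = \<theta> t - \<phi> - 2 * pi * of_int k" for k :: int and t
  have cos_z: "cos (z k t) = cos (\<theta> t - \<phi>)" for k t
    unfolding z_def by (simp add: cos_diff[of "\<theta> t - \<phi>"] sin_int_2pin cos_int_2pin)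
  have dz: "(z k has_real_derivative a * (cos (z k t) - cos \<theta>star)) (at t within {0..})"
    if "0 \<le> t" for k t
    \<comment> \<open>The cosine is rewritten while z is still folded; only then is z expanded for
      differentiation.\<close>
    unfolding cos_z a_def unfolding z_def[abs_def]
    by (rule derivative_eq_intros closed_loop_orientation_derivative[OF cl that] refl
        | simp add: \<nu> algebra_simps)+
  have \<theta>0: "\<theta> 0 = \<mu> * (D rin - dstar)"
    using assms(8) by (auto simp: closed_loop_def)
  have P_iff: "cond_P D \<mu> dstar \<phi> \<theta>star rin \<longleftrightarrow>
      (\<exists>k::int. \<theta> 0 = \<phi> + \<theta>star + 2 * pi * of_int k \<or> \<theta> 0 = \<phi> - \<theta>star + 2 * pi * of_int k)"
    unfolding cond_P_def \<theta>0 ..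

  \<comment> \<open>Case (i): the orientation is constant\<close>
  have straight: "straight_motion D vbar \<theta>star \<nu> r d" if "cond_P D \<mu> dstar \<phi> \<theta>star rin"
  proof -
    have "\<exists>k. z k 0 = \<theta>star \<or> z k 0 = - \<theta>star"
      using that unfolding P_iff z_def by (elim ex_forward) linarith
    then obtain k where "z k 0 = \<theta>star \<or> z k 0 = - \<theta>star" by blast
    then have "cos (z k 0) = cos \<theta>star" by auto
    then have eq: "cos (\<theta> t - \<phi>) = cos \<theta>star" if "0 \<le> t" for t
      using cos_dynamics_dichotomy[OF a dz that] cos_z by metis
    have const: "\<theta> t = \<theta> 0" if "0 \<le> t" for t
    proof (rule has_derivative_zero_unique[of "{0..}" \<theta>])
      show "(\<theta> has_derivative (\<lambda>h. 0)) (at u within {0..})" if "u \<in> {0..}" for u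
        using closed_loop_orientation_derivative[OF cl, of u] eq[of u] that \<nu>
        by (simp add: has_field_derivative_def lambda_zero)
    qed (use that in auto)
    show ?thesis
      by (rule closed_loop_orientation_constant[OF assms(1,2) eq _ _ \<nu> D assms(8) const]) (use s in auto)
  qed

  \<comment> \<open>Case (ii): convergence to a stable orientation\<close>
  have "(\<exists>rin' r' \<theta>' d' (k::int).
            closed_loop D vbar \<mu> \<nu> dstar rin' r' \<theta>' d' \<and>
            cond_P D \<mu> dstar \<phi> \<theta>star rin' \<and>
            straight_motion D vbar \<theta>star \<nu> r' d' \<and>
            (\<forall>t\<ge>0. \<theta>' t = \<phi> + \<theta>star + 2 * pi * of_int k) \<and>
            (\<exists>C c. c > 0 \<and>
               (\<forall>t\<ge>0. norm (r t - r' t) \<le> C * exp (- c * t) \<and>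
                      \<bar>\<theta> t - \<theta>' t\<bar> \<le> C * exp (- c * t)))) \<and>
        (\<exists>T\<ge>0. strict_mono_on {T..} d) \<and>
        (\<exists>ddot. (\<forall>t\<ge>0. (d has_real_derivative ddot t) (at t within {0..})) \<and>
              (ddot \<longlongrightarrow> \<nu>) at_top) \<and>
        (strict_mono_on {0..} \<theta> \<or> strict_antimono_on {0..} \<theta>) \<and>
        (\<exists>\<theta>inf. (\<theta> \<longlongrightarrow> \<theta>inf) at_top \<and> \<bar>\<theta>inf - \<theta> 0\<bar> < 2 * pi)"
    if nP: "\<not> cond_P D \<mu> dstar \<phi> \<theta>star rin"
  proof -
    \<comment> \<open>The floor puts \<open>z k 0\<close> in the period [-\<theta>star, 2 pi -
      \<theta>star). Failure of (P) then excludes the left end and the interior equilibrium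
      \<theta>star.\<close>
    define k where "k = \<lfloor>(\<theta> 0 - \<phi> + \<theta>star) / (2 * pi)\<rfloor>"
    have "of_int k \<le> (\<theta> 0 - \<phi> + \<theta>star) / (2 * pi)" "(\<theta> 0 - \<phi> + \<theta>star) / (2 * pi) < of_int k + 1"
      unfolding k_def by linarith+
    then have "- \<theta>star \<le> z k 0" "z k 0 < 2 * pi - \<theta>star"
      by (auto simp: z_def field_simps)
    moreover have "z k 0 \<noteq> - \<theta>star" "z k 0 \<noteq> \<theta>star"
      using nP unfolding P_iff z_def by (smt (verit))+
    ultimately have init: "- \<theta>star < z k 0" "z k 0 < 2 * pi - \<theta>star" "z k 0 \<noteq> \<theta>star" by auto
    define \<alpha> where "\<alpha> = \<phi> + \<theta>star + 2 * pi * of_int k"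
    have cos_\<alpha>: "cos (\<alpha> - \<phi>) = cos \<theta>star"
      by (simp add: \<alpha>_def cos_add sin_int_2pin cos_int_2pin)
    have z_\<alpha>: "z k t - \<theta>star = \<theta> t - \<alpha>" for t by (simp add: z_def \<alpha>_def)
    note conv = cos_dynamics_convergence[OF a s dz init]
    from conv(2) obtain c where c: "c > 0"
      and \<theta>_le: "\<And>t. 0 \<le> t \<Longrightarrow> \<bar>\<theta> t - \<alpha>\<bar> \<le> \<bar>\<theta> 0 - \<alpha>\<bar> * exp (- c * t)"
      unfolding z_\<alpha> by blast
    define K where "K = \<bar>\<theta> 0 - \<alpha>\<bar>"
    from closed_loop_limit_point[OF cl cos_\<alpha> \<nu> assms(2) c \<theta>_le]
    obtain p where p: "\<alpha> = \<mu> * (linear_field n \<phi> D0 p - dstar)"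
      and r_le: "\<And>t. 0 \<le> t \<Longrightarrow>
        norm (r t - (p + (vbar * t) *\<^sub>R evec \<alpha>)) \<le> vbar * K / c * exp (- c * t)"
      unfolding K_def by blast
    define r' where "r' t = p + (vbar * t) *\<^sub>R evec \<alpha>" for t
    have cl': "closed_loop D vbar \<mu> \<nu> dstar p r' (\<lambda>t. \<alpha>) (\<lambda>t. D (r' t))"
      unfolding D r'_def by (rule closed_loop_straight_line[OF cos_\<alpha> \<nu> p])
    have P': "cond_P D \<mu> dstar \<phi> \<theta>star p"
      unfolding cond_P_def D p[symmetric] \<alpha>_def by blast
    have st': "straight_motion D vbar \<theta>star \<nu> r' (\<lambda>t. D (r' t))"
      using s by (intro closed_loop_orientation_constant[OF assms(1,2) cos_\<alpha> _ _ \<nu> D cl']) auto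
    \<comment> \<open>One constant serves both the position and the orientation error.\<close>
    define C where "C = max K (vbar * K / c)"
    have "norm (r t - r' t) \<le> C * exp (- c * t) \<and> \<bar>\<theta> t - \<alpha>\<bar> \<le> C * exp (- c * t)" if "0 \<le> t" for t
    proof
      have "vbar * K / c * exp (- c * t) \<le> C * exp (- c * t)" "K * exp (- c * t) \<le> C * exp (- c * t)"
        by (intro mult_right_mono; simp add: C_def)+
      then show "norm (r t - r' t) \<le> C * exp (- c * t)" "\<bar>\<theta> t - \<alpha>\<bar> \<le> C * exp (- c * t)"
        using r_le[OF that] \<theta>_le[OF that] unfolding r'_def K_def by linarith+
    qed
    with cl' P' st' c have part1: "\<exists>rin' r' \<theta>' d' (k::int).
            closed_loop D vbar \<mu> \<nu> dstar rin' r' \<theta>' d' \<and>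
            cond_P D \<mu> dstar \<phi> \<theta>star rin' \<and>
            straight_motion D vbar \<theta>star \<nu> r' d' \<and>
            (\<forall>t\<ge>0. \<theta>' t = \<phi> + \<theta>star + 2 * pi * of_int k) \<and>
            (\<exists>C c. c > 0 \<and>
               (\<forall>t\<ge>0. norm (r t - r' t) \<le> C * exp (- c * t) \<and>
                      \<bar>\<theta> t - \<theta>' t\<bar> \<le> C * exp (- c * t)))"
      by (intro exI[of _ p] exI[of _ r'] exI[of _ "\<lambda>t. \<alpha>"] exI[of _ "\<lambda>t. D (r' t)"] exI[of _ k]
          exI[of _ C] exI[of _ c] conjI) (auto simp: \<alpha>_def)
    have lim: "(\<theta> \<longlongrightarrow> \<alpha>) at_top"
      by (rule LIM_zero_cancel, rule Lim_null_comparison[OF _ exp_decay_tendsto_0[OF c, of K]])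
        (rule eventually_mono[OF eventually_ge_at_top[of 0]], use \<theta>_le in \<open>simp add: K_def\<close>)
    define ddot where "ddot t = vbar * n * cos (\<theta> t - \<phi>)" for t
    have dd: "(d has_real_derivative ddot t) (at t within {0..})" if "0 \<le> t" for t
      unfolding ddot_def by (rule closed_loop_field_derivative[OF cl that])
    have "(ddot \<longlongrightarrow> vbar * n * cos (\<alpha> - \<phi>)) at_top"
      unfolding ddot_def by (intro tendsto_intros lim)
    then have ddlim: "(ddot \<longlongrightarrow> \<nu>) at_top" using cos_\<alpha> \<nu> by simp
    then have "\<forall>\<^sub>F t in at_top. 0 < ddot t" using assms(4) by (rule order_tendstoD)
    then obtain T where "\<And>t. T \<le> t \<Longrightarrow> 0 < ddot t"
      by (auto simp: eventually_at_top_linorder)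
    \<comment> \<open>The time T from the limit may be negative, hence the maximum with 0.\<close>
    then have "strict_mono_on {max T 0..} d"
      by (intro strict_mono_on_half_line[OF dd]) auto
    then have part2: "\<exists>T\<ge>0. strict_mono_on {T..} d" by (intro exI[of _ "max T 0"]) auto
    have "strict_mono_on {0..} \<theta> \<or> strict_antimono_on {0..} \<theta>"
      using conv(1) by (simp add: z_def monotone_on_def)
    \<comment> \<open>Both \<open>z k 0\<close> and \<theta>star lie strictly inside the same
      interval of length 2 pi.\<close>
    moreover have "\<bar>\<alpha> - \<theta> 0\<bar> < 2 * pi" using init s z_\<alpha>[of 0] by linarith
    ultimately show ?thesis using part1 part2 dd ddlim lim by blast
  qed
  with straight show ?thesis by blast
qed

end
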